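(* Let $G$ be an abelian group, let $A\subseteq G$ be a finite subset, and let $k$ be an integer with $2\leqslant k\leqslant |A|-2$. Then \[|k\wedge A|\geqslant |A|\] unless $k\in\{2,|A|-2\}$ and $A$ is a $2$-coset. Furthermore, \[|k\wedge A|>|A|\] unless $A$ is a coset of a subgroup of $G$, or $k\in\{2,|A|-2\}$ and either (i) $A$ is an almost $2$-coset, or (ii) $|A|=4$ and $A$ is the union of two cosets of a subgroup of $G$ of order $2$.
   Context: For a finite subset $A$ of an abelian group $G$ and a positive integer $k$, $k\wedge A:=\{\sum_{a\in B}a : B\subseteq A,\ |B|=k\}$ is the set of sums of $k$ distinct elements of $A$. An elementary $2$-subgroup of $G$ is a finite subgroup in which every non-identity element has order $2$ (equivalently, a subgroup isomorphic to $\mathbb{Z}_2^d$ for some $d$). A $2$-coset is a coset of an elementary $2$-subgroup of $G$; an almost $2$-coset is a set obtained from a $2$-coset by removing exactly one element. *)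

theory Defs
  imports "HOL-Algebra.Coset" "HOL-Algebra.FiniteProduct" "HOL-Algebra.Multiplicative_Group"
begin

text \<open>Abelian groups are \<^locale>\<open>comm_group\<close>s, written multiplicatively as in the library:
  a sum over a set is a \<^const>\<open>finprod\<close>. Since the groups are commutative, right cosets
  are the cosets.\<close>

definition k_sums :: "('a, 'b) monoid_scheme \<Rightarrow> nat \<Rightarrow> 'a set \<Rightarrow> 'a set" where
  "k_sums G k A = {finprod G (\<lambda>a. a) B | B. B \<subseteq> A \<and> card B = k}"

definition coset_of_subgroup :: "('a, 'b) monoid_scheme \<Rightarrow> 'a set \<Rightarrow> bool" where
  "coset_of_subgroup G A \<longleftrightarrow> (\<exists>H. subgroup H G \<and> A \<in> rcosets\<^bsub>G\<^esub> H)"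

definition elementary_2_subgroup :: "('a, 'b) monoid_scheme \<Rightarrow> 'a set \<Rightarrow> bool" where
  "elementary_2_subgroup G H \<longleftrightarrow>
     subgroup H G \<and> finite H \<and> (\<forall>h\<in>H. h \<noteq> \<one>\<^bsub>G\<^esub> \<longrightarrow> group.ord G h = 2)"

definition two_coset :: "('a, 'b) monoid_scheme \<Rightarrow> 'a set \<Rightarrow> bool" where
  "two_coset G A \<longleftrightarrow> (\<exists>H. elementary_2_subgroup G H \<and> A \<in> rcosets\<^bsub>G\<^esub> H)"

definition almost_two_coset :: "('a, 'b) monoid_scheme \<Rightarrow> 'a set \<Rightarrow> bool" where
  "almost_two_coset G A \<longleftrightarrow> (\<exists>C c. two_coset G C \<and> c \<in> C \<and> A = C - {c})"

definition union_of_two_cosets_of_order_2 :: "('a, 'b) monoid_scheme \<Rightarrow> 'a set \<Rightarrow> bool" where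
  "union_of_two_cosets_of_order_2 G A \<longleftrightarrow>
     (\<exists>H. subgroup H G \<and> card H = 2 \<and>
       (\<exists>C \<in> rcosets\<^bsub>G\<^esub> H. \<exists>D \<in> rcosets\<^bsub>G\<^esub> H. A = C \<union> D))"

end

theory Submission
  imports Defs
begin

text \<open>
  Write \<open>n = |A|\<close> and let \<open>S\<close> be the set of \<open>k\<close>-sums; passing to complements in \<open>A\<close>, one may take
  \<open>2k \<le> n\<close>. For distinct \<open>x, y \<in> A\<close>, the translates by \<open>x\<close> and by \<open>y\<close> of the \<open>(k-1)\<close>-sums of
  \<open>A - {x, y}\<close> both lie in \<open>S\<close>, so by induction on \<open>k\<close> the set \<open>S\<close> meets its translate by \<open>x / y\<close>
  in at least \<open>n - 2\<close> elements (unless \<open>k = 3\<close> and \<open>A - {x, y}\<close> is a \<open>2\<close>-coset, when \<open>|S| > n\<close>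
  directly). If \<open>|S| \<le> n\<close>, summing these overlaps over all quotients \<open>x / y\<close> bounds the size of
  the quotient set \<open>D\<close> of \<open>A\<close> by \<open>n + 2 < 3n/2\<close> when \<open>n \<ge> 5\<close>, and such a small quotient
  set is a subgroup. Hence \<open>A\<close> is a coset of \<open>D\<close> with at most two elements removed.

  If an element \<open>t\<close> of the coset of \<open>D\<close> containing \<open>S\<close> is not in \<open>S\<close>, then for every \<open>(k-2)\<close>-subset
  \<open>E\<close> of \<open>A\<close> the equation \<open>c\<^sup>2 = t / \<Prod>E\<close> has many solutions \<open>c \<in> A - E\<close>. For \<open>k \<ge> 3\<close>, varying \<open>E\<close>
  makes squaring surjective on \<open>D\<close>, hence injective, which contradicts having two solutions; so
  \<open>S\<close> is a full coset. For \<open>k = 2\<close> and \<open>D\<close> larger than \<open>S\<close>, the solutions force \<open>D\<close> to be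
  an elementary \<open>2\<close>-group. Only \<open>n = 4\<close> with \<open>|S| = 4\<close> escapes the bound on \<open>D\<close>: there two of the
  three ways of splitting \<open>A\<close> into pairs give equal products.
\<close>

context comm_group
begin

section \<open>Quotient sets (difference sets in multiplicative notation) and when they are
  subgroups\<close>

definition quotient_set :: "'a set \<Rightarrow> 'a set" where
  "quotient_set A = {x \<otimes> inv y | x y. x \<in> A \<and> y \<in> A}"

lemma quotient_setI: "x \<in> A \<Longrightarrow> y \<in> A \<Longrightarrow> x \<otimes> inv y \<in> quotient_set A"
  by (auto simp: quotient_set_def)

lemma finite_quotient_set:
  assumes "finite A" shows "finite (quotient_set A)"
proof -
  have "quotient_set A = (\<lambda>(x, y). x \<otimes> inv y) ` (A \<times> A)"
    by (auto simp: quotient_set_def)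
  with assms show ?thesis by simp
qed

lemma quotient_set_closed: "A \<subseteq> carrier G \<Longrightarrow> quotient_set A \<subseteq> carrier G"
  by (auto simp: quotient_set_def)

lemma one_in_quotient_set:
  assumes "A \<subseteq> carrier G" "A \<noteq> {}" shows "\<one> \<in> quotient_set A"
proof -
  obtain a where "a \<in> A" using assms by auto
  with assms quotient_setI[of a A a] show ?thesis by (auto simp: subset_iff)
qed

lemma card_mult_image:
  assumes "x \<in> carrier G" "A \<subseteq> carrier G"
  shows "card ((\<lambda>a. x \<otimes> a) ` A) = card A"
  using assms by (intro card_image inj_onI) (auto simp: subset_iff)

lemma card_image_mult_inv:
  assumes "x \<in> carrier G" "A \<subseteq> carrier G"
  shows "card ((\<lambda>a. a \<otimes> inv x) ` A) = card A"
  using assms by (intro card_image inj_onI) (auto simp: subset_iff)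

lemma mult_inv_mult_cancel:
  assumes "x \<in> carrier G" "y \<in> carrier G" "r \<in> carrier G"
  shows "x \<otimes> inv y \<otimes> (y \<otimes> r) = x \<otimes> r"
  using assms by (simp add: m_assoc inv_solve_left')

lemma square_div:
  assumes "x \<in> carrier G" "y \<in> carrier G"
  shows "(x \<otimes> inv y) \<otimes> (x \<otimes> inv y) = (x \<otimes> x) \<otimes> inv (y \<otimes> y)"
  using assms by (simp add: inv_mult m_ac)

lemma subset_rcoset_quotient_set:
  assumes "A \<subseteq> carrier G" "a \<in> A"
  shows "A \<subseteq> quotient_set A #> a"
proof
  fix x assume "x \<in> A"
  with assms have "x = x \<otimes> inv a \<otimes> a" "x \<otimes> inv a \<in> quotient_set A"
    by (auto simp: m_assoc subset_iff intro: quotient_setI)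
  then show "x \<in> quotient_set A #> a" by (auto simp: r_coset_def)
qed

lemma card_le_card_quotient_set:
  assumes "A \<subseteq> carrier G" "finite A"
  shows "card A \<le> card (quotient_set A)"
proof (cases "A = {}")
  case False
  then obtain a where a: "a \<in> A" by auto
  have "(\<lambda>x. x \<otimes> inv a) ` A \<subseteq> quotient_set A" using a by (auto intro: quotient_setI)
  from card_mono[OF finite_quotient_set[OF assms(2)] this] card_image_mult_inv[of a A] a assms(1)
  show ?thesis by auto
qed simp

text \<open>For \<open>d = a \<otimes> inv b\<close> with \<open>a\<close>, \<open>b\<close> in
  \<open>A\<close>, the translates of \<open>A\<close> by \<open>inv a\<close> and
  \<open>inv b\<close> both lie in the quotient set, so by \<open>small\<close> they share more than
  half of \<open>card A\<close> elements; each shared element gives \<open>x\<close>,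
  \<open>y\<close> in \<open>A\<close> with \<open>d \<otimes> y = x\<close>. For two quotients
  \<open>d\<close>, \<open>e\<close> the numerators \<open>x\<close> fill more than half of
  \<open>A\<close> each, so some \<open>d \<otimes> y = e \<otimes> z\<close> is common, and
  \<open>d \<otimes> inv e = z \<otimes> inv y\<close>.\<close>

lemma subgroup_quotient_set:
  assumes A: "A \<subseteq> carrier G" "finite A"
    and small: "2 * card (quotient_set A) < 3 * card A"
  shows "subgroup (quotient_set A) G"
proof -
  let ?D = "quotient_set A"
  have ne: "A \<noteq> {}" using small by auto
  have big: "card A < 2 * card {y \<in> A. d \<otimes> y \<in> A}" if d: "d \<in> ?D" for d
  proof -
    obtain a b where ab: "a \<in> A" "b \<in> A" "d = a \<otimes> inv b"
      using d by (auto simp: quotient_set_def)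
    have c: "a \<in> carrier G" "b \<in> carrier G" using ab A by auto
    let ?X = "(\<lambda>x. x \<otimes> inv a) ` A" and ?Y = "(\<lambda>x. x \<otimes> inv b) ` A"
    have "?X \<union> ?Y \<subseteq> ?D" using ab by (auto intro: quotient_setI)
    then have "card (?X \<union> ?Y) \<le> card ?D" by (intro card_mono finite_quotient_set A)
    moreover have "card ?X = card A" "card ?Y = card A"
      using card_image_mult_inv c A by auto
    ultimately have 1: "2 * card A \<le> card ?D + card (?X \<inter> ?Y)"
      using card_Un_Int[of ?X ?Y] A by auto
    have "?X \<inter> ?Y \<subseteq> (\<lambda>y. y \<otimes> inv b) ` {y \<in> A. d \<otimes> y \<in> A}"
    proof
      fix z assume "z \<in> ?X \<inter> ?Y"
      then obtain x y where xy: "x \<in> A" "y \<in> A" "z = x \<otimes> inv a" "z = y \<otimes> inv b" by auto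
      have cc: "x \<in> carrier G" "y \<in> carrier G" using xy A by auto
      have "d \<otimes> y = a \<otimes> (y \<otimes> inv b)" using cc c ab by (simp add: m_ac)
      also have "\<dots> = a \<otimes> (x \<otimes> inv a)" using xy by simp
      also have "\<dots> = x" using cc c by (simp add: m_lcomm[of a x])
      finally show "z \<in> (\<lambda>y. y \<otimes> inv b) ` {y \<in> A. d \<otimes> y \<in> A}"
        using xy by (intro image_eqI[of _ _ y]) auto
    qed
    then have "card (?X \<inter> ?Y) \<le> card {y \<in> A. d \<otimes> y \<in> A}"
      using A by (intro surj_card_le) auto
    with 1 small show ?thesis by linarith
  qed
  have quot: "d \<otimes> inv e \<in> ?D" if d: "d \<in> ?D" and e: "e \<in> ?D" for d e
  proof -
    have c: "d \<in> carrier G" "e \<in> carrier G" using quotient_set_closed[OF A(1)] d e by auto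
    let ?X = "(\<lambda>y. d \<otimes> y) ` {y \<in> A. d \<otimes> y \<in> A}" and ?Y = "(\<lambda>y. e \<otimes> y) ` {y \<in> A. e \<otimes> y \<in> A}"
    have "card ?X = card {y \<in> A. d \<otimes> y \<in> A}" "card ?Y = card {y \<in> A. e \<otimes> y \<in> A}"
      using A c by (auto intro!: card_mult_image)
    with big[OF d] big[OF e] have "card A < card ?X + card ?Y" by simp
    moreover have "card (?X \<union> ?Y) \<le> card A" by (rule card_mono) (use A in auto)
    ultimately have "?X \<inter> ?Y \<noteq> {}"
      using card_Un_disjoint[of ?X ?Y] A by auto
    then obtain y z where yz: "y \<in> A" "z \<in> A" "d \<otimes> y = e \<otimes> z" by auto
    have cc: "y \<in> carrier G" "z \<in> carrier G" using yz A by auto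
    have "d \<otimes> inv e = (d \<otimes> y) \<otimes> inv y \<otimes> inv e" using c cc by (simp add: m_assoc)
    also have "\<dots> = z \<otimes> inv y \<otimes> (e \<otimes> inv e)"
      unfolding yz(3) using c cc by (simp add: m_ac del: r_inv l_inv Units_r_inv Units_l_inv)
    also have "\<dots> = z \<otimes> inv y" using c cc by simp
    finally show ?thesis using yz by (auto intro: quotient_setI)
  qed
  have closed: "?D \<subseteq> carrier G" by (rule quotient_set_closed[OF A(1)])
  have one: "\<one> \<in> ?D" by (rule one_in_quotient_set[OF A(1) ne])
  have inv: "inv d \<in> ?D" if "d \<in> ?D" for d
    using quot[OF one that] that closed by auto
  show ?thesis
  proof (rule subgroupI)
    fix d e assume "d \<in> ?D" "e \<in> ?D"
    then show "d \<otimes> e \<in> ?D" using quot[of d "inv e"] inv[of e] closed by auto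
  qed (use closed one inv in auto)
qed

text \<open>Double counting of the pairs \<open>(d \<otimes> s, s)\<close> in
  \<open>S \<times> S\<close> with \<open>d\<close> a quotient of \<open>A\<close>: such a pair
  determines \<open>d\<close>, the quotient \<open>\<one>\<close> contributes \<open>card S\<close>
  pairs, and every other one at least \<open>q\<close>.\<close>

lemma card_quotient_set_bound:
  assumes A: "A \<subseteq> carrier G" "finite A" "A \<noteq> {}" and S: "S \<subseteq> carrier G" "finite S"
    and overlap: "\<And>x y. x \<in> A \<Longrightarrow> y \<in> A \<Longrightarrow> x \<noteq> y \<Longrightarrow> q \<le> card {s \<in> S. x \<otimes> inv y \<otimes> s \<in> S}"
  shows "card S + (card (quotient_set A) - 1) * q \<le> card S * card S"
proof -
  let ?D = "quotient_set A"
  let ?P = "\<lambda>d. {s \<in> S. d \<otimes> s \<in> S}"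
  have one: "\<one> \<in> ?D" using A by (intro one_in_quotient_set)
  have fin: "finite ?D" using A by (intro finite_quotient_set)
  have "(\<lambda>(d, s). (d \<otimes> s, s)) ` Sigma ?D ?P \<subseteq> S \<times> S" by auto
  moreover have "inj_on (\<lambda>(d, s). (d \<otimes> s, s)) (Sigma ?D ?P)"
    using quotient_set_closed[OF A(1)] S by (auto simp: inj_on_def subset_iff)
  ultimately have "card (Sigma ?D ?P) \<le> card (S \<times> S)"
    using S by (intro card_inj_on_le[of "\<lambda>(d, s). (d \<otimes> s, s)"]) auto
  also have "card (Sigma ?D ?P) = (\<Sum>d\<in>?D. card (?P d))"
    using fin S by (intro card_SigmaI) auto
  also have "\<dots> = card (?P \<one>) + (\<Sum>d\<in>?D - {\<one>}. card (?P d))"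
    using one fin by (simp add: sum.remove)
  also have "?P \<one> = S" using S by auto
  finally have le: "card S + (\<Sum>d\<in>?D - {\<one>}. card (?P d)) \<le> card S * card S"
    by (simp add: card_cartesian_product)
  have "(\<Sum>d\<in>?D - {\<one>}. q) \<le> (\<Sum>d\<in>?D - {\<one>}. card (?P d))"
  proof (rule sum_mono)
    fix d assume "d \<in> ?D - {\<one>}"
    then obtain x y where "x \<in> A" "y \<in> A" "d = x \<otimes> inv y" "d \<noteq> \<one>"
      by (auto simp: quotient_set_def)
    moreover from this have "x \<noteq> y" using A by auto
    ultimately show "q \<le> card (?P d)" using overlap by auto
  qed
  with le one fin show ?thesis by (simp add: card_Diff_singleton)
qed

lemma quotient_set_of_small_overlap:
  assumes A: "A \<subseteq> carrier G" "finite A" and S: "S \<subseteq> carrier G" "finite S"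
    and overlap: "\<And>x y. x \<in> A \<Longrightarrow> y \<in> A \<Longrightarrow> x \<noteq> y \<Longrightarrow>
      card A - 2 \<le> card {s \<in> S. x \<otimes> inv y \<otimes> s \<in> S}"
    and n: "5 \<le> card A" and small: "card S \<le> card A"
  shows "subgroup (quotient_set A) G" and "card (quotient_set A) \<le> card A + 2"
proof -
  have ne: "A \<noteq> {}" using n by auto
  let ?m = "card (quotient_set A)"
  have "card S + (?m - 1) * (card A - 2) \<le> card S * card S"
    using card_quotient_set_bound[OF A ne S overlap] by simp
  moreover obtain q where q: "card A = q + 2" "3 \<le> q"
    using that[of "card A - 2"] n by simp
  moreover have "card S * (card S - 1) \<le> card A * (card A - 1)"
    using small by (intro mult_mono) auto
  ultimately have "(?m - 1) * q \<le> (q + 2) * (q + 1)"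
    by (simp add: diff_mult_distrib2)
  show b: "?m \<le> card A + 2"
  proof (rule ccontr)
    assume "\<not> ?m \<le> card A + 2"
    \<comment> \<open>This would give \<open>q * q + 4 * q \<le> q * q + 3 * q + 2\<close>,
      impossible for \<open>q \<ge> 3\<close>.\<close>
    then have "q + 4 \<le> ?m - 1" using q by simp
    then have "(q + 4) * q \<le> (?m - 1) * q" by (rule mult_right_mono) simp
    with \<open>(?m - 1) * q \<le> (q + 2) * (q + 1)\<close> q(2) show False by (simp add: algebra_simps)
  qed
  show "subgroup (quotient_set A) G"
    \<comment> \<open>\<open>2 * (n + 2) < 3 * n\<close> holds exactly from \<open>n = 5\<close>
      on.\<close>
    using b n by (intro subgroup_quotient_set A) simp
qed

text \<open>Strictness bounds \<open>card S * (card S - 1)\<close> by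
  \<open>(card A - 1) * (card A - 2)\<close>; the factor \<open>card A - 2\<close> then cancels
  against the overlap, so the quotient set cannot exceed \<open>A\<close> in size.\<close>

lemma quotient_set_of_smaller_overlap:
  assumes A: "A \<subseteq> carrier G" "finite A" and S: "S \<subseteq> carrier G" "finite S"
    and overlap: "\<And>x y. x \<in> A \<Longrightarrow> y \<in> A \<Longrightarrow> x \<noteq> y \<Longrightarrow>
      card A - 2 \<le> card {s \<in> S. x \<otimes> inv y \<otimes> s \<in> S}"
    and n: "3 \<le> card A" and small: "card S < card A"
  shows "subgroup (quotient_set A) G" and "card (quotient_set A) = card A"
proof -
  have ne: "A \<noteq> {}" using n by auto
  let ?m = "card (quotient_set A)"
  have 1: "card S + (?m - 1) * (card A - 2) \<le> card S * card S"
    using card_quotient_set_bound[OF A ne S overlap] by simp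
  have 2: "card S * (card S - 1) \<le> (card A - 1) * (card A - 2)"
    using small by (intro mult_mono) auto
  have "card S * card S = card S * (card S - 1) + card S" by (cases "card S") auto
  with 1 2 have "(?m - 1) * (card A - 2) \<le> (card A - 1) * (card A - 2)" by linarith
  then have "?m \<le> card A" using n by auto
  with card_le_card_quotient_set[OF A] show b: "?m = card A" by simp
  show "subgroup (quotient_set A) G"
    using b n by (intro subgroup_quotient_set A) simp
qed

section \<open>Cosets of the quotient set and arithmetic of cosets\<close>

lemma rcoset_eq_of_card:
  assumes A: "A \<subseteq> carrier G" "finite A" "a \<in> A"
    and "subgroup (quotient_set A) G" "card (quotient_set A) = card A"
  shows "A = quotient_set A #> a"
proof (rule card_subset_eq)
  have "quotient_set A #> a \<in> rcosets (quotient_set A)"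
    using assms by (intro rcosetsI subgroup.subset) auto
  then show "card A = card (quotient_set A #> a)"
    using card_rcosets_equal[OF _ subgroup.subset[OF assms(4)]] assms(5) by auto
  show "finite (quotient_set A #> a)"
    using finite_quotient_set[OF A(2)] by (simp add: r_coset_def)
qed (use subset_rcoset_quotient_set A in auto)

lemma coset_of_subgroup_of_card:
  assumes A: "A \<subseteq> carrier G" "finite A" "A \<noteq> {}"
    and "subgroup (quotient_set A) G" "card (quotient_set A) = card A"
  shows "coset_of_subgroup G A"
proof -
  obtain a where a: "a \<in> A" using A by auto
  have "A = quotient_set A #> a" using assms a by (intro rcoset_eq_of_card)
  then have "A \<in> rcosets (quotient_set A)"
    using rcosetsI[of "quotient_set A" a] subgroup.subset[OF assms(4)] a A by auto
  with assms(4) show ?thesis by (auto simp: coset_of_subgroup_def)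
qed

lemma elementary_2_subgroupI:
  assumes "subgroup H G" "finite H" "\<And>h. h \<in> H \<Longrightarrow> h \<otimes> h = \<one>"
  shows "elementary_2_subgroup G H"
  unfolding elementary_2_subgroup_def
proof (intro conjI ballI impI)
  fix h assume h: "h \<in> H" "h \<noteq> \<one>"
  have c: "h \<in> carrier G" using h subgroup.subset[OF assms(1)] by auto
  have "h [^] (2::nat) = \<one>" using assms(3)[OF h(1)] c by (simp add: numeral_2_eq_2)
  then have "ord h dvd 2" using c pow_eq_id by blast
  moreover have "ord h \<noteq> 1" using c h ord_eq_1 by auto
  ultimately show "ord h = 2" using dvd_imp_le[of "ord h" 2] by (cases "ord h = 0") auto
qed (use assms in auto)

lemma rcoset_mult:
  assumes "subgroup D G" "a \<in> carrier G" "b \<in> carrier G" "x \<in> D #> a" "y \<in> D #> b"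
  shows "x \<otimes> y \<in> D #> (a \<otimes> b)"
proof -
  have "D \<lhd> G" using assms(1) by (simp add: normal_iff_subgroup)
  from normal.rcos_sum[OF this assms(2,3)] assms(4,5) show ?thesis
    by (auto simp: set_mult_def)
qed

lemma rcoset_div:
  assumes D: "subgroup D G" and c: "a \<in> carrier G" "b \<in> carrier G"
    and x: "x \<in> D #> (a \<otimes> b)" "y \<in> D #> b"
  shows "x \<otimes> inv y \<in> D #> a"
proof -
  obtain h g where hg: "h \<in> D" "g \<in> D" "x = h \<otimes> (a \<otimes> b)" "y = g \<otimes> b"
    using x by (auto simp: r_coset_def)
  have cc: "h \<in> carrier G" "g \<in> carrier G" using hg subgroup.subset[OF D] by auto
  have "x \<otimes> inv y = h \<otimes> inv g \<otimes> a \<otimes> (b \<otimes> inv b)"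
    unfolding hg using cc c by (simp add: inv_mult m_ac del: r_inv l_inv Units_r_inv Units_l_inv)
  also have "\<dots> = h \<otimes> inv g \<otimes> a" using cc c by simp
  finally have "x \<otimes> inv y = h \<otimes> inv g \<otimes> a" .
  moreover have "h \<otimes> inv g \<in> D" using D hg by (simp add: subgroup.m_closed subgroup.m_inv_closed)
  ultimately show ?thesis by (auto simp: r_coset_def)
qed

section \<open>Products over subsets, complements and overlaps of k-sums\<close>

abbreviation prd :: "'a set \<Rightarrow> 'a" where
  "prd B \<equiv> finprod G (\<lambda>a. a) B"

lemma k_sumsI: "B \<subseteq> A \<Longrightarrow> card B = k \<Longrightarrow> prd B \<in> k_sums G k A"
  by (auto simp: k_sums_def)

lemma prd_closed: "B \<subseteq> carrier G \<Longrightarrow> prd B \<in> carrier G"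
  by (intro finprod_closed) auto

lemma k_sums_closed: "A \<subseteq> carrier G \<Longrightarrow> k_sums G k A \<subseteq> carrier G"
  by (auto simp: k_sums_def intro!: prd_closed)

lemma finite_k_sums: "finite A \<Longrightarrow> finite (k_sums G k A)"
  by (rule finite_subset[of _ "prd ` Pow A"]) (auto simp: k_sums_def)

lemma k_sums_mono: "A \<subseteq> A' \<Longrightarrow> k_sums G k A \<subseteq> k_sums G k A'"
  by (auto simp: k_sums_def)

lemma prd_insert:
  assumes "finite B" "insert x B \<subseteq> carrier G" "x \<notin> B"
  shows "prd (insert x B) = x \<otimes> prd B"
  using assms by (intro finprod_insert) auto

lemma k_sums_1:
  assumes "A \<subseteq> carrier G" shows "k_sums G 1 A = A"
proof -
  have "prd {a} = a" if "a \<in> A" for a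
    using assms that prd_insert[of "{}" a] by (auto simp: subset_iff)
  moreover have "k_sums G 1 A = (\<lambda>a. prd {a}) ` A"
    by (auto simp: k_sums_def card_1_singleton_iff)
  ultimately show ?thesis by simp
qed

lemma mult_k_sums:
  assumes A: "A \<subseteq> carrier G" "finite A" and x: "x \<in> A" and r: "r \<in> k_sums G j (A - {x})"
  shows "x \<otimes> r \<in> k_sums G (Suc j) A"
proof -
  obtain B where B: "B \<subseteq> A - {x}" "card B = j" "r = prd B" using r by (auto simp: k_sums_def)
  have fin: "finite B" using B A by (meson finite_Diff finite_subset)
  have "x \<otimes> r = prd (insert x B)" using B A x fin by (subst prd_insert) auto
  also have "\<dots> \<in> k_sums G (Suc j) A"
    using B x fin by (intro k_sumsI) (auto simp: card_insert_if)
  finally show ?thesis .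
qed

text \<open>Dividing \<open>prd A\<close> by the product of a \<open>k\<close>-subset gives the
  product of its complement. Used for \<open>k\<close> and for \<open>card A - k\<close>, this
  yields equality.\<close>

lemma card_k_sums_complement_le:
  assumes A: "A \<subseteq> carrier G" "finite A" and k: "k \<le> card A"
  shows "card (k_sums G (card A - k) A) \<le> card (k_sums G k A)"
proof -
  have "k_sums G (card A - k) A \<subseteq> (\<lambda>s. prd A \<otimes> inv s) ` k_sums G k A"
  proof
    fix s assume "s \<in> k_sums G (card A - k) A"
    then obtain B where B: "B \<subseteq> A" "card B = card A - k" "s = prd B" by (auto simp: k_sums_def)
    have fin: "finite B" using B A by (meson finite_subset)
    have c: "prd B \<in> carrier G" "prd (A - B) \<in> carrier G" using A B by (auto intro!: prd_closed)
    have "B \<union> (A - B) = A" using B by auto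
    then have "prd A = prd B \<otimes> prd (A - B)"
      using finprod_Un_disjoint[of B "A - B" "\<lambda>a. a"] A B fin by auto
    then have "s = prd A \<otimes> inv (prd (A - B))" using B c by (simp add: m_assoc)
    moreover have "prd (A - B) \<in> k_sums G k A"
      using B k fin by (intro k_sumsI) (auto simp: card_Diff_subset)
    ultimately show "s \<in> (\<lambda>s. prd A \<otimes> inv s) ` k_sums G k A" by auto
  qed
  then show ?thesis using finite_k_sums[OF A(2)] by (intro surj_card_le) auto
qed

lemma card_k_sums_complement:
  assumes A: "A \<subseteq> carrier G" "finite A" and k: "k \<le> card A"
  shows "card (k_sums G (card A - k) A) = card (k_sums G k A)"
  using card_k_sums_complement_le[OF A k] card_k_sums_complement_le[OF A, of "card A - k"] k
  by simp

text \<open>A \<open>j\<close>-sum \<open>r\<close> avoiding both \<open>x\<close> and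
  \<open>y\<close> can be multiplied by either of them, and \<open>x \<otimes> inv y\<close> carries
  \<open>y \<otimes> r\<close> to \<open>x \<otimes> r\<close>.\<close>

lemma k_sums_overlap:
  assumes A: "A \<subseteq> carrier G" "finite A" and xy: "x \<in> A" "y \<in> A" "x \<noteq> y"
  shows "card (k_sums G j (A - {x, y}))
    \<le> card {s \<in> k_sums G (Suc j) A. x \<otimes> inv y \<otimes> s \<in> k_sums G (Suc j) A}"
proof -
  have c: "x \<in> carrier G" "y \<in> carrier G" using xy A by auto
  let ?R = "k_sums G j (A - {x, y})" and ?S = "k_sums G (Suc j) A"
  have R: "?R \<subseteq> carrier G" using A by (intro k_sums_closed) auto
  have "y \<otimes> r \<in> {s \<in> ?S. x \<otimes> inv y \<otimes> s \<in> ?S}" if r: "r \<in> ?R" for r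
  proof -
    have "r \<in> k_sums G j (A - {x})" "r \<in> k_sums G j (A - {y})"
      using r k_sums_mono[of "A - {x, y}" "A - {x}" j] k_sums_mono[of "A - {x, y}" "A - {y}" j]
      by auto
    then have "x \<otimes> r \<in> ?S" "y \<otimes> r \<in> ?S" using A xy by (auto intro!: mult_k_sums)
    moreover have "x \<otimes> inv y \<otimes> (y \<otimes> r) = x \<otimes> r"
      using r R c by (intro mult_inv_mult_cancel) auto
    ultimately show ?thesis by simp
  qed
  then have "(\<lambda>r. y \<otimes> r) ` ?R \<subseteq> {s \<in> ?S. x \<otimes> inv y \<otimes> s \<in> ?S}" by blast
  then have "card ((\<lambda>r. y \<otimes> r) ` ?R) \<le> card {s \<in> ?S. x \<otimes> inv y \<otimes> s \<in> ?S}"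
    using finite_k_sums[OF A(2)] by (intro card_mono) auto
  with card_mult_image[OF c(2) R] show ?thesis by simp
qed

section \<open>Elements of a coset that are missing from the k-sums\<close>

lemma prd_in_rcoset:
  assumes D: "subgroup D G" and a: "a \<in> carrier G" and "finite B" "B \<subseteq> D #> a"
  shows "prd B \<in> D #> (a [^] card B)"
  using assms(3,4)
proof (induction B rule: finite_induct)
  case empty
  show ?case using subgroup.one_closed[OF D] subgroup.subset[OF D] by (simp add: coset_mult_one)
next
  case (insert x B)
  have "insert x B \<subseteq> carrier G"
    using insert.prems r_coset_subset_G[OF subgroup.subset[OF D] a] by blast
  then have "prd (insert x B) = prd B \<otimes> x"
    using insert by (subst prd_insert) (auto intro!: m_comm prd_closed)
  moreover have "prd B \<otimes> x \<in> D #> (a [^] card B \<otimes> a)"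
    using insert D a by (intro rcoset_mult) auto
  ultimately show ?case using insert by simp
qed

lemma exists_missing:
  assumes D: "subgroup D G" "finite D" and a: "a \<in> carrier G" and S: "finite S" "card S < card D"
  shows "\<exists>t. t \<in> (D #> a) - S"
proof -
  have "D #> a \<in> rcosets D" using a by (intro rcosetsI subgroup.subset D)
  then have "card (D #> a) = card D" using card_rcosets_equal[OF _ subgroup.subset[OF D(1)]] by auto
  then have "\<not> D #> a \<subseteq> S" using S card_mono[of S "D #> a"] by auto
  then show ?thesis by auto
qed

text \<open>For \<open>c \<in> A - E\<close>, the element completing \<open>E \<union> {c}\<close> to product \<open>t\<close> must be \<open>c\<close> itself, or lie in
  \<open>E\<close> or in the coset outside \<open>A\<close>.\<close>
lemma card_square_roots_of_missing:
  assumes D: "subgroup D G" "finite D" and a: "a \<in> carrier G" and A: "A \<subseteq> D #> a"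
    and t: "t \<in> D #> (a [^] (j + 2))" "t \<notin> k_sums G (j + 2) A"
    and E: "E \<subseteq> A" "card E = j"
  shows "2 * card A \<le> card {c \<in> A - E. c \<otimes> c = t \<otimes> inv (prd E)} + 2 * j + card D"
proof -
  let ?C = "D #> a" and ?u = "t \<otimes> inv (prd E)"
  let ?F = "{c \<in> A - E. c \<otimes> c = ?u}"
  have C: "?C \<subseteq> carrier G" using r_coset_subset_G[OF subgroup.subset[OF D(1)] a] .
  have finC: "finite ?C" using D by (simp add: r_coset_def)
  have "?C \<in> rcosets D" using a by (intro rcosetsI subgroup.subset D)
  then have cardC: "card ?C = card D"
    using card_rcosets_equal[OF _ subgroup.subset[OF D(1)]] by auto
  have fin: "finite A" "finite E" using A E finC by (auto intro: finite_subset)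
  have tc: "t \<in> carrier G"
    using t(1) r_coset_subset_G[OF subgroup.subset[OF D(1)], of "a [^] (j + 2)"] a by auto
  have Ec: "prd E \<in> carrier G" using E A C by (intro prd_closed) auto
  have u: "?u \<in> D #> (a \<otimes> a)"
  proof (rule rcoset_div[OF D(1)])
    show "prd E \<in> D #> (a [^] j)" using prd_in_rcoset[OF D(1) a fin(2)] E A by auto
    have "a [^] (j + 2) = a \<otimes> a \<otimes> a [^] j" using a by (simp add: m_ac)
    with t(1) show "t \<in> D #> (a \<otimes> a \<otimes> a [^] j)" by simp
  qed (use a in auto)
  have uc: "?u \<in> carrier G" using tc Ec by simp
  \<comment> \<open>Each \<open>c\<close> is recovered from its partner
    \<open>y = ?u \<otimes> inv c\<close> as \<open>?u \<otimes> inv y\<close>, so those outside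
    \<open>?F\<close> number at most \<open>j + (card D - card A)\<close>.\<close>
  have "A - E \<subseteq> ?F \<union> (\<lambda>y. ?u \<otimes> inv y) ` (E \<union> (?C - A))"
  proof
    fix c assume c: "c \<in> A - E"
    have cc: "c \<in> carrier G" using c A C by auto
    define y where "y = ?u \<otimes> inv c"
    have y: "y \<in> ?C" unfolding y_def using c A by (intro rcoset_div[OF D(1) a a u]) auto
    have yc: "y \<in> carrier G" using y C by auto
    have uy: "?u = y \<otimes> c" unfolding y_def using uc cc by (simp add: m_assoc)
    have cy: "c = ?u \<otimes> inv y" unfolding uy using yc cc by (simp add: m_comm[of y c] m_assoc)
    have "y = c" if yA: "y \<in> A - E"
    proof (rule ccontr)
      assume "y \<noteq> c"
      then have "prd (insert y (insert c E)) \<in> k_sums G (j + 2) A"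
        using c yA E fin by (intro k_sumsI) auto
      moreover have "prd (insert y (insert c E)) = y \<otimes> (c \<otimes> prd E)"
      proof -
        have "prd (insert y (insert c E)) = y \<otimes> prd (insert c E)"
          using \<open>y \<noteq> c\<close> c yA E A C fin by (intro prd_insert) auto
        also have "prd (insert c E) = c \<otimes> prd E"
          using c E A C fin by (intro prd_insert) auto
        finally show ?thesis .
      qed
      moreover have "y \<otimes> (c \<otimes> prd E) = t"
      proof -
        have "y \<otimes> (c \<otimes> prd E) = ?u \<otimes> prd E" unfolding uy using yc cc Ec by (simp add: m_assoc)
        also have "\<dots> = t" using tc Ec by (simp add: m_assoc)
        finally show ?thesis .
      qed
      ultimately show False using t(2) by simp
    qed
    then show "c \<in> ?F \<union> (\<lambda>y. ?u \<otimes> inv y) ` (E \<union> (?C - A))"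
    proof (cases "y \<in> A - E")
      case True
      with c uy \<open>y \<in> A - E \<Longrightarrow> y = c\<close> show ?thesis by simp
    next
      case False
      with y have "y \<in> E \<union> (?C - A)" by auto
      with cy show ?thesis by blast
    qed
  qed
  then have "card (A - E) \<le> card (?F \<union> (\<lambda>y. ?u \<otimes> inv y) ` (E \<union> (?C - A)))"
    using fin finC by (intro card_mono) auto
  also have "\<dots> \<le> card ?F + card ((\<lambda>y. ?u \<otimes> inv y) ` (E \<union> (?C - A)))" by (rule card_Un_le)
  also have "\<dots> \<le> card ?F + card (E \<union> (?C - A))"
    using fin finC by (intro add_left_mono card_image_le) auto
  also have "\<dots> \<le> card ?F + (card E + card (?C - A))" by (intro add_left_mono card_Un_le)
  also have "card (?C - A) = card D - card A"
    using A fin cardC by (simp add: card_Diff_subset)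
  also have "card (A - E) = card A - j" using E fin by (simp add: card_Diff_subset)
  finally show ?thesis
    using E card_mono[OF fin(1) E(1)] card_mono[OF finC A] cardC by linarith
qed

text \<open>A missing \<open>t\<close> would make squaring on the finite quotient group surjective
  and yet not injective.\<close>

lemma card_quotient_set_le_card_k_sums:
  assumes A: "A \<subseteq> carrier G" "finite A" and D: "subgroup (quotient_set A) G"
    and small: "card (quotient_set A) \<le> card A + 2" and k: "1 \<le> j" "2 * (j + 2) \<le> card A"
  shows "card (quotient_set A) \<le> card (k_sums G (j + 2) A)"
proof (rule ccontr)
  let ?D = "quotient_set A" and ?S = "k_sums G (j + 2) A"
  assume "\<not> card ?D \<le> card ?S"
  moreover obtain a where a: "a \<in> A" using k by fastforce
  have ac: "a \<in> carrier G" using a A by auto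
  ultimately obtain t where t: "t \<in> ?D #> (a [^] (j + 2))" "t \<notin> ?S"
    using exists_missing[OF D finite_quotient_set[OF A(2)], of "a [^] (j + 2)" ?S] finite_k_sums[OF A(2)]
    by auto
  have tc: "t \<in> carrier G"
    using t(1) r_coset_subset_G[OF subgroup.subset[OF D], of "a [^] (j + 2)"] ac by auto
  define F where "F E = {c \<in> A - E. c \<otimes> c = t \<otimes> inv (prd E)}" for E
  have F: "2 \<le> card (F E)" if "E \<subseteq> A" "card E = j" for E
  proof -
    have "2 * card A \<le> card (F E) + 2 * j + card ?D"
      unfolding F_def
      by (rule card_square_roots_of_missing[OF D finite_quotient_set[OF A(2)] ac
          subset_rcoset_quotient_set[OF A(1) a] t that])
    \<comment> \<open>The bound leaves \<open>card (F E) \<ge> card A - 2 * j - 2\<close>, and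
      \<open>2 * j + 4 \<le> card A\<close>.\<close>
    then show ?thesis using small k by simp
  qed
  have sq: "\<exists>d \<in> ?D. d \<otimes> d = x \<otimes> inv y" if xy: "x \<in> A" "y \<in> A" "x \<noteq> y" for x y
  proof -
    have xyc: "x \<in> carrier G" "y \<in> carrier G" using xy A by auto
    \<comment> \<open>Completing a common core \<open>E\<close> of \<open>j - 1\<close> elements by
      \<open>y\<close> or by \<open>x\<close> gives two \<open>j\<close>-sets whose targets
      \<open>t \<otimes> inv (prd _)\<close> differ by the factor \<open>x \<otimes> inv y\<close>;
      the quotient of a root of each is a root of that factor.\<close>
    have "j - 1 \<le> card (A - {x, y})" using xy A k by (simp add: card_Diff_subset)
    then obtain E where E: "E \<subseteq> A - {x, y}" "card E = j - 1" "finite E"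
      by (rule obtain_subset_with_card_n)
    have "2 \<le> card (F (insert y E))" "2 \<le> card (F (insert x E))"
      using E k xy by (auto intro!: F simp: card_insert_if subset_iff)
    then obtain c c' where c: "c \<in> F (insert y E)" "c' \<in> F (insert x E)"
      by fastforce
    have cc: "c \<in> carrier G" "c' \<in> carrier G" using c A by (auto simp: F_def)
    have Ec: "prd E \<in> carrier G" using E A by (intro prd_closed) auto
    have "prd (insert y E) = y \<otimes> prd E" "prd (insert x E) = x \<otimes> prd E"
      using E A xy by (intro prd_insert; auto)+
    then have "c \<otimes> c = t \<otimes> inv (y \<otimes> prd E)" "c' \<otimes> c' = t \<otimes> inv (x \<otimes> prd E)"
      using c by (auto simp: F_def)
    then have "(c \<otimes> inv c') \<otimes> (c \<otimes> inv c') = t \<otimes> inv (y \<otimes> prd E) \<otimes> inv (t \<otimes> inv (x \<otimes> prd E))"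
      using square_div[OF cc] by simp
    also have "\<dots> = x \<otimes> inv y \<otimes> (t \<otimes> inv t) \<otimes> (prd E \<otimes> inv (prd E))"
      using tc xyc Ec by (simp add: inv_mult m_ac del: r_inv l_inv Units_r_inv Units_l_inv)
    also have "\<dots> = x \<otimes> inv y" using tc xyc Ec by simp
    finally show ?thesis using c by (auto simp: F_def intro!: quotient_setI)
  qed
  have "?D \<subseteq> (\<lambda>d. d \<otimes> d) ` ?D"
  proof
    fix d assume "d \<in> ?D"
    then obtain x y where xy: "x \<in> A" "y \<in> A" "d = x \<otimes> inv y" by (auto simp: quotient_set_def)
    show "d \<in> (\<lambda>d. d \<otimes> d) ` ?D"
    proof (cases "x = y")
      case True
      then have "d = \<one> \<otimes> \<one>" using xy A by auto
      then show ?thesis using subgroup.one_closed[OF D] by blast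
    next
      case False
      then obtain e where "e \<in> ?D" "e \<otimes> e = d" using sq[OF xy(1,2)] xy(3) by auto
      then show ?thesis by blast
    qed
  qed
  then have inj: "inj_on (\<lambda>d. d \<otimes> d) ?D"
    using finite_quotient_set[OF A(2)] by (intro finite_surj_inj)
  \<comment> \<open>Two distinct roots for a single \<open>E\<close> have a quotient other than
    \<open>\<one>\<close> whose square is \<open>\<one>\<close>.\<close>
  obtain E where E: "E \<subseteq> A" "card E = j"
    using obtain_subset_with_card_n[of j A] k by auto
  then have "\<not> card (F E) \<le> 1" using F[OF E] by linarith
  moreover have "finite (F E)" using A by (simp add: F_def)
  ultimately obtain c c' where c: "c \<in> F E" "c' \<in> F E" "c \<noteq> c'"
    by (auto simp: card_le_Suc0_iff_eq)
  have cc: "c \<in> carrier G" "c' \<in> carrier G" using c A by (auto simp: F_def)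
  have "(c \<otimes> inv c') \<otimes> (c \<otimes> inv c') = \<one> \<otimes> \<one>"
  proof -
    have "c \<otimes> c = c' \<otimes> c'" using c by (simp add: F_def)
    then show ?thesis using square_div[OF cc] cc by simp
  qed
  moreover have "c \<otimes> inv c' \<in> ?D" "\<one> \<in> ?D"
    using c subgroup.one_closed[OF D] by (auto simp: F_def intro: quotient_setI)
  ultimately have "c \<otimes> inv c' = \<one>" by (rule inj_onD[OF inj])
  then have "c \<otimes> inv c' = c' \<otimes> inv c'" using cc by simp
  then show False using c(3) cc right_cancel[of "inv c'" c c'] by blast
qed

section \<open>Three-element sums when all but two elements form a 2-coset\<close>

lemma mult_in_k_sums_2:
  assumes A: "A \<subseteq> carrier G" "finite A" and "x \<in> A" "y \<in> A" "x \<noteq> y"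
  shows "x \<otimes> y \<in> k_sums G 2 A"
proof -
  have "y \<in> k_sums G 1 (A - {x})" using assms by (subst k_sums_1) auto
  from mult_k_sums[OF A assms(3) this] show ?thesis by (simp add: numeral_2_eq_2)
qed

lemma mult_in_k_sums_3:
  assumes A: "A \<subseteq> carrier G" "finite A"
    and "x \<in> A" "y \<in> A" "z \<in> A" "x \<noteq> y" "x \<noteq> z" "y \<noteq> z"
  shows "x \<otimes> (y \<otimes> z) \<in> k_sums G 3 A"
proof -
  have "y \<otimes> z \<in> k_sums G 2 (A - {x})" using assms by (intro mult_in_k_sums_2) auto
  from mult_k_sums[OF A assms(3) this] show ?thesis by (simp add: eval_nat_numeral)
qed

lemma two_cosetD:
  assumes "two_coset G Q"
  obtains c where "c \<in> carrier G" "\<And>p. p \<in> Q \<Longrightarrow> p \<otimes> p = c"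
    "\<And>p q r. p \<in> Q \<Longrightarrow> q \<in> Q \<Longrightarrow> r \<in> Q \<Longrightarrow> p \<otimes> q \<otimes> inv r \<in> Q"
proof -
  obtain H g where H: "elementary_2_subgroup G H" and g: "g \<in> carrier G" "Q = H #> g"
    using assms by (auto simp: two_coset_def RCOSETS_def)
  have sub: "subgroup H G" using H by (simp add: elementary_2_subgroup_def)
  have "p \<otimes> p = g \<otimes> g" if p: "p \<in> Q" for p
  proof -
    obtain h where h: "h \<in> H" "p = h \<otimes> g" using p g by (auto simp: r_coset_def)
    have hc: "h \<in> carrier G" using h subgroup.subset[OF sub] by auto
    have "h \<otimes> h = \<one>"
    proof (cases "h = \<one>")
      case False
      then have "ord h = 2" using H h by (simp add: elementary_2_subgroup_def)
      then show ?thesis using pow_ord_eq_1[OF hc] hc by (simp add: numeral_2_eq_2)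
    qed simp
    moreover have "p \<otimes> p = h \<otimes> h \<otimes> (g \<otimes> g)" using h hc g by (simp add: m_ac)
    ultimately show ?thesis using g by simp
  qed
  moreover have "p \<otimes> q \<otimes> inv r \<in> Q" if "p \<in> Q" "q \<in> Q" "r \<in> Q" for p q r
    using that g rcoset_mult[OF sub g(1) g(1)] rcoset_div[OF sub g(1) g(1)] by simp
  ultimately show ?thesis using that[of "g \<otimes> g"] g by auto
qed

text \<open>With \<open>Q = A - {x, y}\<close> and \<open>c\<close> the common square of its
  elements, the sums inside \<open>Q\<close> cover \<open>c \<otimes> q\<close> for all
  \<open>q\<close> in \<open>Q\<close>, and the sums \<open>x \<otimes> p \<otimes> r\<close> with
  \<open>p\<close> fixed give \<open>card Q - 1\<close> more; a coincidence would put
  \<open>x\<close> into \<open>Q\<close>. In total there are at least \<open>2 * card A - 5\<close>,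
  which exceeds \<open>card A\<close> from 6 on.\<close>

lemma card_k_sums_3_of_two_coset:
  assumes A: "A \<subseteq> carrier G" "finite A" and xy: "x \<in> A" "y \<in> A" "x \<noteq> y"
    and Q: "two_coset G (A - {x, y})" and n: "6 \<le> card A"
  shows "card A < card (k_sums G 3 A)"
proof -
  define Q where "Q = A - {x, y}"
  have QA: "Q \<subseteq> A" "x \<notin> Q" and Qc: "Q \<subseteq> carrier G" and fin: "finite Q"
    using A by (auto simp: Q_def)
  have cardQ: "card Q = card A - 2" using xy A by (simp add: Q_def card_Diff_subset)
  have xc: "x \<in> carrier G" using xy A by auto
  obtain c where c: "c \<in> carrier G" "\<And>p. p \<in> Q \<Longrightarrow> p \<otimes> p = c"
    "\<And>p q r. p \<in> Q \<Longrightarrow> q \<in> Q \<Longrightarrow> r \<in> Q \<Longrightarrow> p \<otimes> q \<otimes> inv r \<in> Q"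
    using two_cosetD[OF Q] unfolding Q_def by blast
  have split: "q \<otimes> c = p \<otimes> (r \<otimes> (q \<otimes> p \<otimes> inv r))" if pqr: "p \<in> Q" "q \<in> Q" "r \<in> Q" for p q r
  proof -
    have cc: "p \<in> carrier G" "q \<in> carrier G" "r \<in> carrier G" using pqr Qc by auto
    have "p \<otimes> (r \<otimes> (q \<otimes> p \<otimes> inv r)) = q \<otimes> (p \<otimes> p) \<otimes> (r \<otimes> inv r)"
      using cc by (simp add: m_ac del: r_inv l_inv Units_r_inv Units_l_inv)
    then show ?thesis using cc c pqr by simp
  qed
  have "card Q \<noteq> 0" using cardQ n by simp
  then obtain p where p: "p \<in> Q" by fastforce
  have pc: "p \<in> carrier G" using p Qc by auto
  let ?T = "(\<lambda>q. c \<otimes> q) ` Q" and ?U = "(\<lambda>r. (x \<otimes> p) \<otimes> r) ` (Q - {p})"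
  have "?T \<subseteq> k_sums G 3 A"
  proof
    fix w assume "w \<in> ?T"
    then obtain q where q: "q \<in> Q" "w = c \<otimes> q" by auto
    have qc: "q \<in> carrier G" using q Qc by auto
    have "2 \<le> card (Q - {q})" using q fin cardQ n by simp
    then obtain W where "W \<subseteq> Q - {q}" "card W = 2" using obtain_subset_with_card_n by metis
    then obtain p' r where pr: "p' \<in> Q" "r \<in> Q" "p' \<noteq> q" "r \<noteq> q" "p' \<noteq> r"
      by (auto simp: card_2_iff)
    have cc: "p' \<in> carrier G" "r \<in> carrier G" using pr Qc by auto
    \<comment> \<open>The third factor, chosen so that
      \<open>p' \<otimes> r \<otimes> v = q \<otimes> (p' \<otimes> p')\<close>. If it coincided
      with \<open>p'\<close> or \<open>r\<close>, cancelling the square \<open>c\<close> would give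
      \<open>q = r\<close> or \<open>q = p'\<close>.\<close>
    define v where "v = q \<otimes> p' \<otimes> inv r"
    have vQ: "v \<in> Q" unfolding v_def using q pr by (intro c)
    then have vc: "v \<in> carrier G" using Qc by auto
    have w: "q \<otimes> c = p' \<otimes> (r \<otimes> v)" unfolding v_def using pr q by (intro split)
    have "p' \<noteq> v"
    proof
      assume "p' = v"
      then have "q \<otimes> c = r \<otimes> (p' \<otimes> p')" using w cc by (simp add: m_ac)
      then show False using c pr cc qc by simp
    qed
    moreover have "r \<noteq> v"
    proof
      assume "r = v"
      then have "q \<otimes> c = p' \<otimes> (r \<otimes> r)" using w by simp
      then show False using c pr cc qc by simp
    qed
    ultimately have "p' \<otimes> (r \<otimes> v) \<in> k_sums G 3 A"
      using pr vQ QA by (intro mult_in_k_sums_3 A) auto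
    then show "w \<in> k_sums G 3 A" using w q qc c by (simp add: m_comm)
  qed
  moreover have "?U \<subseteq> k_sums G 3 A"
  proof
    fix w assume "w \<in> ?U"
    then obtain r where r: "r \<in> Q" "r \<noteq> p" "w = x \<otimes> p \<otimes> r" by auto
    then have "x \<otimes> (p \<otimes> r) \<in> k_sums G 3 A"
      using p xy QA by (intro mult_in_k_sums_3 A) auto
    then show "w \<in> k_sums G 3 A" using r p Qc xc by (simp add: m_assoc subset_iff)
  qed
  moreover have "?T \<inter> ?U = {}"
  proof (rule ccontr)
    assume "?T \<inter> ?U \<noteq> {}"
    then obtain q r where qr: "q \<in> Q" "r \<in> Q" "c \<otimes> q = x \<otimes> p \<otimes> r" by auto
    have cc: "q \<in> carrier G" "r \<in> carrier G" using qr Qc by auto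
    have v: "q \<otimes> p \<otimes> inv r \<in> Q" using qr p by (intro c)
    then have vc: "q \<otimes> p \<otimes> inv r \<in> carrier G" using Qc by auto
    have "x \<otimes> (p \<otimes> r) = q \<otimes> c" using qr(3) c(1) cc pc xc by (simp add: m_comm[of q] m_assoc)
    also have "\<dots> = p \<otimes> (r \<otimes> (q \<otimes> p \<otimes> inv r))" by (rule split[OF p qr(1,2)])
    also have "\<dots> = (q \<otimes> p \<otimes> inv r) \<otimes> (p \<otimes> r)" using cc pc by (simp add: m_ac)
    finally have "x = q \<otimes> p \<otimes> inv r" using vc xc cc pc by simp
    then show False using v QA by simp
  qed
  ultimately have "card ?T + card ?U \<le> card (k_sums G 3 A)"
    using finite_k_sums[OF A(2)] fin
    by (subst card_Un_disjoint[symmetric]) (auto intro!: card_mono)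
  moreover have "card ?T = card Q" using Qc c by (intro card_mult_image) auto
  moreover have "card ?U = card Q - 1"
    using Qc p pc xc fin by (subst card_mult_image) auto
  ultimately show ?thesis using cardQ n by simp
qed

section \<open>Passing from k to k + 1\<close>

text \<open>\<open>IH\<close> on \<open>A - {x, y}\<close> makes all overlaps at least
  \<open>card A - 2\<close>, its exception being excluded by
  \<open>card_k_sums_3_of_two_coset\<close>. Then \<open>card A\<close>, the size of the quotient
  set and the number of sums are squeezed together. \<open>IH\<close> is a hypothesis so that the
  step serves both inside the induction and afterwards, for the equality case.\<close>

lemma k_sums_step:
  assumes A: "A \<subseteq> carrier G" "finite A" and k: "2 \<le> k" "2 * Suc k \<le> card A"
    and small: "card (k_sums G (Suc k) A) \<le> card A"
    and IH: "\<And>B. B \<subseteq> carrier G \<Longrightarrow> finite B \<Longrightarrow> 2 * k \<le> card B \<Longrightarrow>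
      card (k_sums G k B) < card B \<Longrightarrow> k = 2 \<and> two_coset G B"
  shows "coset_of_subgroup G A" and "card (k_sums G (Suc k) A) = card A"
proof -
  let ?S = "k_sums G (Suc k) A" and ?D = "quotient_set A"
  have overlap: "card A - 2 \<le> card {s \<in> ?S. x \<otimes> inv y \<otimes> s \<in> ?S}"
    if xy: "x \<in> A" "y \<in> A" "x \<noteq> y" for x y
  proof -
    let ?B = "A - {x, y}"
    have cardB: "card ?B = card A - 2" using xy A by (simp add: card_Diff_subset)
    have "card ?B \<le> card (k_sums G k ?B)"
    proof (rule ccontr)
      assume "\<not> ?thesis"
      moreover have "?B \<subseteq> carrier G" "finite ?B" "2 * k \<le> card ?B" using A cardB k by auto
      ultimately have "k = 2" "two_coset G ?B" using IH[of ?B] by auto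
      then have "card A < card (k_sums G 3 A)"
        using card_k_sums_3_of_two_coset[OF A xy] k by simp
      then show False using small \<open>k = 2\<close> by (simp add: eval_nat_numeral)
    qed
    also have "\<dots> \<le> card {s \<in> ?S. x \<otimes> inv y \<otimes> s \<in> ?S}" by (rule k_sums_overlap[OF A xy])
    finally show ?thesis using cardB by simp
  qed
  have D: "subgroup ?D G" "card ?D \<le> card A + 2"
    using quotient_set_of_small_overlap[OF A k_sums_closed[OF A(1)] finite_k_sums[OF A(2)] overlap _ small]
      k by auto
  have "card ?D \<le> card (k_sums G ((k - 1) + 2) A)"
    using k by (intro card_quotient_set_le_card_k_sums A D) auto
  then have le: "card ?D \<le> card ?S" using k by (simp add: eval_nat_numeral)
  with card_le_card_quotient_set[OF A] small show "card ?S = card A" by simp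
  have "A \<noteq> {}" using k by auto
  then show "coset_of_subgroup G A"
    using le card_le_card_quotient_set[OF A] small by (intro coset_of_subgroup_of_card A D) auto
qed

section \<open>Two-element sums, and the lower bound for all k\<close>

lemma k_sums_2_overlap:
  assumes A: "A \<subseteq> carrier G" "finite A" and xy: "x \<in> A" "y \<in> A" "x \<noteq> y"
  shows "card A - 2 \<le> card {s \<in> k_sums G 2 A. x \<otimes> inv y \<otimes> s \<in> k_sums G 2 A}"
proof -
  have "k_sums G 1 (A - {x, y}) = A - {x, y}" using A by (intro k_sums_1) auto
  moreover have "card (A - {x, y}) = card A - 2" using xy A by (simp add: card_Diff_subset)
  ultimately show ?thesis using k_sums_overlap[OF A xy, of 1] by (simp add: numeral_2_eq_2)
qed

lemma card_square_roots_of_missing_2: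
  assumes D: "subgroup D G" "finite D" and a: "a \<in> carrier G" and A: "A \<subseteq> D #> a"
    and t: "t \<in> D #> (a \<otimes> a)" "t \<notin> k_sums G 2 A"
  shows "2 * card A \<le> card {c \<in> A. c \<otimes> c = t} + card D"
proof -
  have "t \<in> carrier G" using t(1) r_coset_subset_G[OF subgroup.subset[OF D(1)], of "a \<otimes> a"] a by auto
  moreover have "a [^] (0 + 2::nat) = a \<otimes> a" using a by (simp add: numeral_2_eq_2)
  ultimately show ?thesis
    using card_square_roots_of_missing[OF D a A, of t 0 "{}"] t by (simp add: numeral_2_eq_2)
qed

text \<open>Here \<open>A\<close> is a full coset of its quotient group, so the count of square
  roots of a missing \<open>t\<close> forces every element of \<open>A\<close> to square to
  \<open>t\<close>; all quotients then square to \<open>\<one>\<close>.\<close>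

lemma two_coset_of_card_k_sums_2:
  assumes A: "A \<subseteq> carrier G" "finite A" and n: "3 \<le> card A" and small: "card (k_sums G 2 A) < card A"
  shows "two_coset G A"
proof -
  let ?D = "quotient_set A"
  have D: "subgroup ?D G" "card ?D = card A"
    using quotient_set_of_smaller_overlap[OF A k_sums_closed[OF A(1)] finite_k_sums[OF A(2)]
        k_sums_2_overlap[OF A] n small] by auto
  have finD: "finite ?D" using A by (intro finite_quotient_set)
  obtain a where a: "a \<in> A" using n by fastforce
  have ac: "a \<in> carrier G" using a A by auto
  obtain t where t: "t \<in> ?D #> (a \<otimes> a)" "t \<notin> k_sums G 2 A"
    using exists_missing[OF D(1) finD, of "a \<otimes> a" "k_sums G 2 A"] finite_k_sums[OF A(2)] ac small D
    by auto
  have "card A \<le> card {c \<in> A. c \<otimes> c = t}"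
    using card_square_roots_of_missing_2[OF D(1) finD ac subset_rcoset_quotient_set[OF A(1) a] t] D
    by simp
  then have "{c \<in> A. c \<otimes> c = t} = A" using A by (intro card_seteq) auto
  then have sq: "c \<otimes> c = t" if "c \<in> A" for c using that by auto
  have tc: "t \<in> carrier G" using sq[OF a] ac by auto
  have "d \<otimes> d = \<one>" if "d \<in> ?D" for d
  proof -
    obtain x y where xy: "x \<in> A" "y \<in> A" "d = x \<otimes> inv y"
      using \<open>d \<in> ?D\<close> by (auto simp: quotient_set_def)
    then show ?thesis using square_div[of x y] sq tc A by (auto simp: subset_iff)
  qed
  then have "elementary_2_subgroup G ?D" using D finD by (intro elementary_2_subgroupI)
  moreover have "A \<in> rcosets ?D"
    using rcoset_eq_of_card[OF A a D] rcosetsI[OF subgroup.subset[OF D(1)] ac] by simp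
  ultimately show ?thesis by (auto simp: two_coset_def)
qed

text \<open>The exception does not propagate: having fewer than \<open>card A\<close> sums for
  \<open>Suc k\<close> already triggers \<open>k_sums_step\<close>, which returns equality.\<close>

lemma card_k_sums_ge:
  assumes "A \<subseteq> carrier G" "finite A" "2 \<le> k" "2 * k \<le> card A" "card (k_sums G k A) < card A"
  shows "k = 2 \<and> two_coset G A"
  using assms(3,1,2,4,5)
proof (induction k arbitrary: A rule: dec_induct)
  case base
  then show ?case using two_coset_of_card_k_sums_2[of A] by auto
next
  case (step k)
  have "card (k_sums G (Suc k) A) = card A"
    by (rule k_sums_step(2)) (use step in auto)
  with step show ?case by simp
qed

lemma k_sums_2_large:
  assumes A: "A \<subseteq> carrier G" "finite A" and n: "5 \<le> card A" and small: "card (k_sums G 2 A) \<le> card A"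
  shows "coset_of_subgroup G A \<or> almost_two_coset G A"
proof -
  let ?D = "quotient_set A" and ?S = "k_sums G 2 A"
  have D: "subgroup ?D G" "card ?D \<le> card A + 2"
    using quotient_set_of_small_overlap[OF A k_sums_closed[OF A(1)] finite_k_sums[OF A(2)]
        k_sums_2_overlap[OF A] n small] by auto
  have finD: "finite ?D" using A by (intro finite_quotient_set)
  have finS: "finite ?S" using A by (intro finite_k_sums)
  obtain a where a: "a \<in> A" using n by fastforce
  have ac: "a \<in> carrier G" using a A by auto
  let ?C = "?D #> a"
  have AC: "A \<subseteq> ?C" by (rule subset_rcoset_quotient_set[OF A(1) a])
  have Crc: "?C \<in> rcosets ?D" using ac by (intro rcosetsI subgroup.subset D)
  then have cardC: "card ?C = card ?D"
    using card_rcosets_equal[OF _ subgroup.subset[OF D(1)]] by auto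
  have finC: "finite ?C" using finD by (simp add: r_coset_def)
  have roots: "2 * card A \<le> card {c \<in> A. c \<otimes> c = t} + card ?D"
    if "t \<in> ?D #> (a \<otimes> a)" "t \<notin> ?S" for t
    by (rule card_square_roots_of_missing_2[OF D(1) finD ac AC that])
  consider "card ?D = card A" | "card ?D = card A + 1" | "card ?D = card A + 2"
    using D(2) card_le_card_quotient_set[OF A] by linarith
  then show ?thesis
  proof cases
    case 1
    have "A \<noteq> {}" using n by auto
    with 1 show ?thesis using coset_of_subgroup_of_card[OF A _ D(1)] by simp
  next
    case 2
    obtain t where t: "t \<in> ?D #> (a \<otimes> a)" "t \<notin> ?S"
      using exists_missing[OF D(1) finD, of "a \<otimes> a" ?S] finS ac small 2 by auto
    let ?X = "{c \<in> A. c \<otimes> c = t}"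
    \<comment> \<open>All but at most one element of \<open>A\<close> square to \<open>t\<close>.
      Below, \<open>?X\<close> and its translate by \<open>d\<close> lie in a coset of size
      \<open>card A + 1 < 2 * (card A - 1)\<close>, so they meet and \<open>d\<close> is a quotient
      of two roots of \<open>t\<close>.\<close>
    have X: "card A \<le> card ?X + 1" using roots[OF t] 2 by simp
    have "d \<otimes> d = \<one>" if d: "d \<in> ?D" for d
    proof -
      have dc: "d \<in> carrier G" using d subgroup.subset[OF D(1)] by auto
      have "(\<lambda>c. d \<otimes> c) ` ?X \<subseteq> ?C"
      proof
        fix z assume "z \<in> (\<lambda>c. d \<otimes> c) ` ?X"
        then obtain c where c: "c \<in> A" "z = d \<otimes> c" by auto
        have "d \<in> ?D #> \<one>" using d subgroup.subset[OF D(1)] by (simp add: coset_mult_one)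
        then show "z \<in> ?C" using rcoset_mult[OF D(1) one_closed ac, of d c] c AC ac by auto
      qed
      then have "card ((\<lambda>c. d \<otimes> c) ` ?X \<union> ?X) \<le> card ?C"
        using AC finC by (intro card_mono) auto
      moreover have "card ((\<lambda>c. d \<otimes> c) ` ?X) = card ?X"
        using dc A by (intro card_mult_image) auto
      ultimately have "(\<lambda>c. d \<otimes> c) ` ?X \<inter> ?X \<noteq> {}"
        using card_Un_disjoint[of "(\<lambda>c. d \<otimes> c) ` ?X" ?X] A X cardC 2 n by auto
      then obtain c c' where c: "c \<in> ?X" "c' \<in> ?X" "c' = d \<otimes> c" by auto
      have cc: "c \<in> carrier G" "c' \<in> carrier G" using c A by auto
      have "d = c' \<otimes> inv c" using c cc dc by (simp add: m_assoc)
      then show ?thesis using square_div[OF cc(2,1)] c cc by auto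
    qed
    then have "elementary_2_subgroup G ?D" using D finD by (intro elementary_2_subgroupI)
    then have "two_coset G ?C" using Crc by (auto simp: two_coset_def)
    moreover have "card (?C - A) = 1" using AC A cardC 2 by (simp add: card_Diff_subset)
    then obtain e where "?C - A = {e}" by (auto simp: card_1_singleton_iff)
    then have "e \<in> ?C" "A = ?C - {e}" using AC by auto
    ultimately show ?thesis by (auto simp: almost_two_coset_def)
  next
    case 3
    obtain t where t: "t \<in> ?D #> (a \<otimes> a)" "t \<notin> ?S"
      using exists_missing[OF D(1) finD, of "a \<otimes> a" ?S] finS ac small 3 by auto
    \<comment> \<open>There is room for a second missing element. Each of the two has at least
      \<open>card A - 2\<close> roots in \<open>A\<close>, and these root sets are disjoint, which
      is too many for \<open>card A \<ge> 5\<close>.\<close>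
    have "card (insert t ?S) < card ?D"
      using finS small 3 by (simp add: card_insert_if)
    then obtain t' where t': "t' \<in> ?D #> (a \<otimes> a)" "t' \<notin> ?S" "t \<noteq> t'"
      using exists_missing[OF D(1) finD, of "a \<otimes> a" "insert t ?S"] finS ac by auto
    let ?X = "{c \<in> A. c \<otimes> c = t}" and ?Y = "{c \<in> A. c \<otimes> c = t'}"
    have "card (?X \<union> ?Y) = card ?X + card ?Y"
      using A t'(3) by (intro card_Un_disjoint) auto
    moreover have "card (?X \<union> ?Y) \<le> card A" using A by (intro card_mono) auto
    ultimately have False using roots[OF t] roots[OF t'(1,2)] 3 n by simp
    then show ?thesis ..
  qed
qed

section \<open>Four-element sets\<close>

text \<open>The subgroup is generated by \<open>h = q \<otimes> inv r\<close>: combining the two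
  equations gives \<open>q \<otimes> q = r \<otimes> r\<close>, and the second gives
  \<open>h \<otimes> s = p\<close>, so the cosets are \<open>{q, r}\<close> and
  \<open>{p, s}\<close>.\<close>

lemma union_of_two_cosets_of_order_2I:
  assumes c: "p \<in> carrier G" "q \<in> carrier G" "r \<in> carrier G" "s \<in> carrier G"
    and ne: "q \<noteq> r" and eq: "p \<otimes> q = r \<otimes> s" "p \<otimes> r = q \<otimes> s"
  shows "union_of_two_cosets_of_order_2 G {p, q, r, s}"
proof -
  define h where "h = q \<otimes> inv r"
  have hc: "h \<in> carrier G" using c by (simp add: h_def)
  have "(q \<otimes> q) \<otimes> (p \<otimes> s) = (p \<otimes> q) \<otimes> (q \<otimes> s)" using c by (simp add: m_ac)
  also have "\<dots> = (r \<otimes> s) \<otimes> (p \<otimes> r)" using eq by simp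
  also have "\<dots> = (r \<otimes> r) \<otimes> (p \<otimes> s)" using c by (simp add: m_ac)
  finally have "q \<otimes> q = r \<otimes> r" using c by simp
  then have hh: "h \<otimes> h = \<one>" using square_div[OF c(2,3)] c by (simp add: h_def)
  have h1: "h \<noteq> \<one>"
  proof
    assume "h = \<one>"
    then have "q \<otimes> inv r = r \<otimes> inv r" using c by (simp add: h_def)
    then show False using c ne right_cancel[of "inv r" q r] by blast
  qed
  have hinv: "inv h = h" using hh hc by (intro inv_equality)
  have "subgroup {\<one>, h} G" by (rule subgroupI) (use hc hh hinv in auto)
  moreover have "card {\<one>, h} = 2" using h1 by auto
  moreover have "{\<one>, h} #> r = {r, q}"
    using c by (auto simp: r_coset_def h_def m_assoc)
  moreover have "{\<one>, h} #> s = {s, p}"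
  proof -
    have "h \<otimes> s = inv r \<otimes> (q \<otimes> s)" using c by (simp add: h_def m_ac)
    also have "\<dots> = inv r \<otimes> (r \<otimes> p)" using eq c by (simp add: m_comm)
    also have "\<dots> = p" using c by (simp add: m_assoc[symmetric])
    finally show ?thesis using c by (auto simp: r_coset_def)
  qed
  moreover have "{\<one>, h} #> r \<in> rcosets {\<one>, h}" "{\<one>, h} #> s \<in> rcosets {\<one>, h}"
    using hc c by (auto intro!: rcosetsI)
  moreover have "{p, q, r, s} = {r, q} \<union> {s, p}" by auto
  ultimately show ?thesis unfolding union_of_two_cosets_of_order_2_def by metis
qed

text \<open>Pairs sharing an element have different products by cancellation, so only complementary
  pairs can collide. Two splittings without collision give four products, and the third adds
  one.\<close>

lemma five_le_card_k_sums_2: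
  assumes A: "A \<subseteq> carrier G" "finite A" and pqrs: "p \<in> A" "q \<in> A" "r \<in> A" "s \<in> A"
    and ne: "p \<noteq> q" "p \<noteq> r" "p \<noteq> s" "q \<noteq> r" "q \<noteq> s" "r \<noteq> s"
    and neq: "p \<otimes> q \<noteq> r \<otimes> s" "p \<otimes> r \<noteq> q \<otimes> s"
  shows "5 \<le> card (k_sums G 2 A)"
proof -
  have c: "p \<in> carrier G" "q \<in> carrier G" "r \<in> carrier G" "s \<in> carrier G" using pqrs A by auto
  let ?T = "{p \<otimes> q, r \<otimes> s, p \<otimes> r, q \<otimes> s, p \<otimes> s}"
  have "?T \<subseteq> k_sums G 2 A" using pqrs ne by (auto intro!: mult_in_k_sums_2 A)
  then have "card ?T \<le> card (k_sums G 2 A)" by (intro card_mono finite_k_sums A)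
  moreover have "p \<otimes> q \<noteq> p \<otimes> r" "p \<otimes> q \<noteq> p \<otimes> s" "p \<otimes> r \<noteq> p \<otimes> s"
    "r \<otimes> s \<noteq> q \<otimes> s" "r \<otimes> s \<noteq> p \<otimes> s" "q \<otimes> s \<noteq> p \<otimes> s"
    using c ne by auto
  moreover have "p \<otimes> q \<noteq> q \<otimes> s" using c ne m_comm[of p q] by auto
  moreover have "r \<otimes> s \<noteq> p \<otimes> r" using c ne m_comm[of p r] by auto
  ultimately show ?thesis using neq by simp
qed

lemma k_sums_2_of_card_4:
  assumes A: "A \<subseteq> carrier G" and n: "card A = 4" and small: "card (k_sums G 2 A) \<le> 4"
  shows "union_of_two_cosets_of_order_2 G A"
proof -
  have fin: "finite A" using n by (intro card_ge_0_finite) simp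
  obtain p q r s where A_eq: "A = {p, q, r, s}"
    and ne: "p \<noteq> q" "p \<noteq> r" "p \<noteq> s" "q \<noteq> r" "q \<noteq> s" "r \<noteq> s"
    using n by (auto simp: card_Suc_eq eval_nat_numeral)
  have c: "p \<in> carrier G" "q \<in> carrier G" "r \<in> carrier G" "s \<in> carrier G" using A A_eq by auto
  have "\<not> 5 \<le> card (k_sums G 2 A)" using small by simp
  \<comment> \<open>Among any two of the three splittings one has equal products, so at least two of
    the three do.\<close>
  then have 1: "p \<otimes> q = r \<otimes> s \<or> p \<otimes> r = q \<otimes> s"
    and 2: "p \<otimes> q = s \<otimes> r \<or> p \<otimes> s = q \<otimes> r"
    and 3: "p \<otimes> r = s \<otimes> q \<or> p \<otimes> s = r \<otimes> q"
    using five_le_card_k_sums_2[OF A fin, of p q r s] five_le_card_k_sums_2[OF A fin, of p q s r]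
      five_le_card_k_sums_2[OF A fin, of p r s q] ne A_eq by auto
  have comm: "s \<otimes> r = r \<otimes> s" "r \<otimes> q = q \<otimes> r" "s \<otimes> q = q \<otimes> s" using c by (auto simp: m_comm)
  from 1 2 3 consider "p \<otimes> q = r \<otimes> s" "p \<otimes> r = q \<otimes> s" | "p \<otimes> q = s \<otimes> r" "p \<otimes> s = q \<otimes> r"
    | "p \<otimes> r = s \<otimes> q" "p \<otimes> s = r \<otimes> q"
    unfolding comm by blast
  then show ?thesis
  proof cases
    case 1
    then show ?thesis unfolding A_eq using c ne by (intro union_of_two_cosets_of_order_2I)
  next
    case 2
    have "A = {p, q, s, r}" using A_eq by auto
    then show ?thesis using 2 c ne by (auto intro!: union_of_two_cosets_of_order_2I)
  next
    case 3
    have "A = {p, r, s, q}" using A_eq by auto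
    then show ?thesis using 3 c ne by (auto intro!: union_of_two_cosets_of_order_2I)
  qed
qed

section \<open>The equality case and the reduction by complements\<close>

lemma card_k_sums_gt:
  assumes A: "A \<subseteq> carrier G" "finite A" and k: "2 \<le> k" "2 * k \<le> card A"
    and small: "card (k_sums G k A) \<le> card A"
  shows "coset_of_subgroup G A \<or>
    (k = 2 \<and> (almost_two_coset G A \<or> (card A = 4 \<and> union_of_two_cosets_of_order_2 G A)))"
proof (cases "k = 2")
  case True
  then show ?thesis
    using k_sums_2_large[OF A] k_sums_2_of_card_4[OF A(1)] small k
    by (cases "card A = 4") auto
next
  case False
  have "coset_of_subgroup G A"
  \<comment> \<open>The lower bound just proved, at \<open>k - 1 \<ge> 2\<close>, serves as the
    induction hypothesis of the step.\<close>
  proof (rule k_sums_step(1)[OF A, of "k - 1"])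
    show "k - 1 = 2 \<and> two_coset G B" if "B \<subseteq> carrier G" "finite B" "2 * (k - 1) \<le> card B"
      "card (k_sums G (k - 1) B) < card B" for B
      using False k by (intro card_k_sums_ge that) auto
  qed (use False k small in auto)
  then show ?thesis ..
qed

end

theorem theorem1:
  fixes G :: "('a, 'b) monoid_scheme" and A :: "'a set" and k :: nat
  assumes "comm_group G"
    and "A \<subseteq> carrier G" and "finite A"
    and "2 \<le> k" and "k \<le> card A - 2"
  shows "(\<not> (k \<in> {2, card A - 2} \<and> two_coset G A)
            \<longrightarrow> card (k_sums G k A) \<ge> card A) \<and>
         (\<not> (coset_of_subgroup G A \<or>
              (k \<in> {2, card A - 2} \<and>
                (almost_two_coset G A \<or>
                 (card A = 4 \<and> union_of_two_cosets_of_order_2 G A))))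
            \<longrightarrow> card (k_sums G k A) > card A)"
proof -
  interpret comm_group G by fact
  note A = assms(2,3)
  \<comment> \<open>Complements reduce to \<open>2 * l \<le> card A\<close>; \<open>l = 2\<close>
    means \<open>k = 2\<close> or \<open>k = card A - 2\<close>. The subtraction is not truncated,
    since \<open>2 \<le> k \<le> card A - 2\<close> forces \<open>card A \<ge> 4\<close>.\<close>
  define l where "l = min k (card A - k)"
  have l: "2 \<le> l" "2 * l \<le> card A" "l = 2 \<Longrightarrow> k \<in> {2, card A - 2}"
    using assms(4,5) by (auto simp: l_def min_def split: if_splits)
  have eq: "card (k_sums G l A) = card (k_sums G k A)"
    using card_k_sums_complement[OF A, of k] assms(5) by (auto simp: l_def min_def)
  have "card A \<le> card (k_sums G k A) \<or> (k \<in> {2, card A - 2} \<and> two_coset G A)"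
    using card_k_sums_ge[OF A l(1,2)] l(3) unfolding eq by linarith
  moreover have "card A < card (k_sums G k A) \<or> coset_of_subgroup G A \<or>
    (k \<in> {2, card A - 2} \<and>
      (almost_two_coset G A \<or> (card A = 4 \<and> union_of_two_cosets_of_order_2 G A)))"
    using card_k_sums_gt[OF A l(1,2)] l(3) unfolding eq by (meson not_less)
  ultimately show ?thesis by blast
qed

end
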